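(* Let $p$ be a prime number, let $N,n,r$ be positive integers, and put $A:=(\mathbb{Z}/p\mathbb{Z})^N$. Let $f_1,\dots,f_r:A^n\to A$ be nonzero functions (not identically zero). Put $Z:=\{x\in A^n\mid f_1(x)=0,\dots,f_r(x)=0\}$. Then $$\operatorname{ord}_p(\#Z)\;\ge\;\left\lceil\frac{N\bigl(n-\sum_{j=1}^r\operatorname{fdeg}(f_j)\bigr)}{\max_{1\le j\le r}\operatorname{fdeg}(f_j)}\right\rceil .$$
   Context: For commutative groups $G,B$, a function $f:G\to B$ and $a\in G$, let $\Delta_a f:G\to B$ be $\Delta_a f(x)=f(x+a)-f(x)$. The functional degree is $$\operatorname{fdeg}(f)=\sup\{n\in\mathbb{N}\mid \exists\, a_1,\dots,a_n\in G,\ \Delta_{a_1}\cdots\Delta_{a_n}f\ne 0\}\in\mathbb{N}\cup\{-\infty,\infty\},$$ where $\mathbb{N}=\{0,1,2,\dots\}$ and $\sup\emptyset=-\infty$. (In the situation of the claim all functional degrees are finite and non-negative.) For a nonzero integer $m$, $\operatorname{ord}_p(m)$ is the exponent of the largest power of $p$ dividing $m$, and $\operatorname{ord}_p(0)=\infty$. If the maximum in the denominator is $0$ (all $f_j$ are nonzero constants), the right-hand side is read as $+\infty$. *)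

theory Defs
  imports
    "HOL-Analysis.Finite_Cartesian_Product"
    "HOL-Library.Extended_Real"
    "Berlekamp_Zassenhaus.Finite_Field"
begin

definition fwd_diff :: "'g::ab_group_add \<Rightarrow> ('g \<Rightarrow> 'b::ab_group_add) \<Rightarrow> 'g \<Rightarrow> 'b"  ("\<Delta>") where
  "\<Delta> a f = (\<lambda>x. f (x + a) - f x)"

(* Values in {-\<infinity>, 0, 1, 2, ..., \<infinity>}: on ereal the supremum of the empty set is -\<infinity>.
   foldr \<Delta> [a1, ..., an] f is \<Delta> a1 (... (\<Delta> an f)). *)
definition fdeg :: "('g::ab_group_add \<Rightarrow> 'b::ab_group_add) \<Rightarrow> ereal" where
  "fdeg f = Sup {ereal (real n) | n. \<exists>as. length as = n \<and> foldr \<Delta> as f \<noteq> (\<lambda>_. 0)}"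

(* The library's multiplicity p 0 is 0, hence the case distinction. *)
definition ordp :: "nat \<Rightarrow> int \<Rightarrow> ereal" where
  "ordp p m = (if m = 0 then \<infinity> else ereal (real (multiplicity (int p) m)))"

definition ereal_ceiling :: "ereal \<Rightarrow> ereal" where
  "ereal_ceiling x = (if \<bar>x\<bar> = \<infinity> then x else ereal (of_int \<lceil>real_of_ereal x\<rceil>))"

(* On ereal, division of a positive number by 0 gives \<infinity>; so the quotient below a ceiling is
   automatically read as \<infinity> when all functions involved are nonzero constants. *)
lemma ereal_ceiling_divide_zero:
  assumes "x > 0"
  shows "ereal_ceiling (x / 0) = \<infinity>"
  using assms by (simp add: ereal_ceiling_def divide_ereal_def)

end

theory Submission
  imports Defs
begin

text \<open>
  Call \<open>h : G \<rightarrow> \<int>\<close> of \<open>p\<close>-adic degree at most \<open>e\<close> with step \<open>c\<close> if \<open>k\<close>-fold differences of \<open>h\<close> are divisible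
  by \<open>p\<close> to the power \<open>\<lceil>(k - e) / c\<rceil>\<close>. These degrees add up under products. The identity
  \<open>1 + T + \<dots> + T\<^bsup>p-1\<^esup> = \<Delta>\<^bsup>p-1\<^esup> + p(\<dots>)\<close>, with \<open>T = 1 + \<Delta>\<close> a unit translation, shows that summing
  over one coordinate of \<open>\<bbbF>\<^sub>p\<^sup>M\<close> lowers the degree by \<open>p - 1\<close> as soon as \<open>p - 1 \<le> c\<close>. Hence the sum of \<open>h\<close>
  over \<open>\<bbbF>\<^sub>p\<^sup>M\<close> is divisible by \<open>p\<close> to the power \<open>\<lceil>(M(p - 1) - e) / c\<rceil>\<close>.

  Since \<open>T\<^sup>p = 1\<close> on \<open>\<bbbF>\<^sub>p\<close>, \<open>\<Delta>\<^sup>p\<close> is \<open>p\<close> times a combination of lower powers of \<open>\<Delta>\<close>, so the indicator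
  function of 0 on \<open>\<bbbF>\<^sub>p\<close> has degree at most \<open>p - 1\<close> with step \<open>p - 1\<close>. Composing with a function of
  functional degree \<open>d\<close> multiplies both numbers by \<open>d\<close>. The indicator function of \<open>Z\<close> is a product of
  such compositions, one for each coordinate of each \<open>f\<^sub>j\<close>; the sum over all points is \<open>#Z\<close>.
\<close>

section \<open>Iterated differences\<close>

lemma foldr_fwd_diff_add:
  "foldr \<Delta> as (\<lambda>x. g x + h x) = (\<lambda>x. foldr \<Delta> as g x + foldr \<Delta> as h x)"
  by (induction as) (auto simp: fwd_diff_def)

lemma foldr_fwd_diff_mult_left:
  fixes h :: "'g::ab_group_add \<Rightarrow> 'r::ring"
  shows "foldr \<Delta> as (\<lambda>x. m * h x) = (\<lambda>x. m * foldr \<Delta> as h x)"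
  by (induction as) (auto simp: fwd_diff_def algebra_simps)

lemma foldr_fwd_diff_shift:
  "foldr \<Delta> as (\<lambda>x. h (x + b)) = (\<lambda>x. foldr \<Delta> as h (x + b))"
  by (induction as) (auto simp: fwd_diff_def ac_simps)

lemma foldr_fwd_diff_zero: "foldr \<Delta> as (\<lambda>_. 0) = (\<lambda>_. 0)"
  by (induction as) (auto simp: fwd_diff_def)

lemma foldr_fwd_diff_nth:
  "foldr \<Delta> as (\<lambda>x. h x $ i) = (\<lambda>x. foldr \<Delta> as h x $ i)"
  by (induction as) (auto simp: fwd_diff_def)

lemma fwd_diff_commute: "\<Delta> a (\<Delta> b h) = \<Delta> b (\<Delta> a h)"
  by (auto simp: fwd_diff_def fun_eq_iff algebra_simps)

lemma fwd_diff_foldr: "\<Delta> a (foldr \<Delta> as h) = foldr \<Delta> as (\<Delta> a h)"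
  by (induction as) (auto simp: fwd_diff_commute)

text \<open>Translation by \<open>a\<close> is 1 + \<open>\<Delta> a\<close>; this is the binomial
  expansion of its \<open>n\<close>-th power. The multiples of \<open>a\<close> are given by a
  recursion, so that both \<open>of_nat\<close> and points on a coordinate axis fit.\<close>

lemma newton_forward:
  fixes b :: "nat \<Rightarrow> 'g::ab_group_add" and h :: "'g \<Rightarrow> int"
  assumes b: "b 0 = 0" "\<And>t. b (Suc t) = b t + a"
  shows "h (x + b n) = (\<Sum>k\<le>n. int (n choose k) * (\<Delta> a ^^ k) h x)"
proof (induction n arbitrary: h)
  case 0
  then show ?case by (simp add: b)
next
  case (Suc n)
  let ?D = "\<lambda>k. (\<Delta> a ^^ k) h x"
  have "h (x + b (Suc n)) = h (x + b n) + \<Delta> a h (x + b n)"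
    by (simp add: b fwd_diff_def ac_simps)
  also have "\<dots> = (\<Sum>k\<le>n. int (n choose k) * ?D k) + (\<Sum>k\<le>n. int (n choose k) * ?D (Suc k))"
    by (simp add: Suc.IH funpow_swap1)
  \<comment> \<open>The added term vanishes, since \<open>n choose Suc n\<close> is 0; the two sums
    now match for Pascal's rule.\<close>
  also have "(\<Sum>k\<le>n. int (n choose k) * ?D k) = (\<Sum>k\<le>Suc n. int (n choose k) * ?D k)"
    by simp
  also have "\<dots> = ?D 0 + (\<Sum>k\<le>n. int (n choose Suc k) * ?D (Suc k))"
    by (subst sum.atMost_Suc_shift) simp
  finally show ?case
    by (subst sum.atMost_Suc_shift) (simp add: sum.distrib algebra_simps)
qed

text \<open>With T = 1 + \<open>\<Delta> a\<close>, this is the geometric sum (T^n - 1) / (T -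
  1).\<close>

lemma sum_newton_forward:
  fixes b :: "nat \<Rightarrow> 'g::ab_group_add" and h :: "'g \<Rightarrow> int"
  assumes b: "b 0 = 0" "\<And>t. b (Suc t) = b t + a"
  shows "(\<Sum>t<n. h (x + b t)) = (\<Sum>k<n. int (n choose Suc k) * (\<Delta> a ^^ k) h x)"
proof (induction n)
  case (Suc n)
  let ?D = "\<lambda>k. (\<Delta> a ^^ k) h x"
  have "(\<Sum>k<n. int (n choose Suc k) * ?D k) = (\<Sum>k<Suc n. int (n choose Suc k) * ?D k)"
    by simp
  moreover have "(\<Sum>t<Suc n. h (x + b t)) = (\<Sum>k<n. int (n choose Suc k) * ?D k) + (\<Sum>k<Suc n. int (n choose k) * ?D k)"
    unfolding sum.lessThan_Suc[of "\<lambda>t. h (x + b t)"] Suc.IH newton_forward[of b, OF b, of h x n]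
    by (simp only: lessThan_Suc_atMost)
  ultimately show ?case
    by (simp add: sum.distrib algebra_simps del: sum.lessThan_Suc)
qed simp

section \<open>The p-adic degree filtration\<close>

text \<open>Truncated to 0 for negative \<open>k\<close>.\<close>

definition ceil_quot :: "nat \<Rightarrow> int \<Rightarrow> nat" where
  "ceil_quot c k = nat \<lceil>real_of_int k / real c\<rceil>"

lemma ceil_quot_mono: "k \<le> l \<Longrightarrow> ceil_quot c k \<le> ceil_quot c l"
  unfolding ceil_quot_def by (intro nat_mono ceiling_mono divide_right_mono) auto

lemma ceil_quot_add_le: "ceil_quot c (k + l) \<le> ceil_quot c k + ceil_quot c l"
proof -
  have "\<lceil>real_of_int (k + l) / real c\<rceil> \<le> \<lceil>real_of_int k / real c\<rceil> + \<lceil>real_of_int l / real c\<rceil>"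
    by (simp add: add_divide_distrib ceiling_add_le)
  then show ?thesis
    unfolding ceil_quot_def by linarith
qed

lemma ceil_quot_self: "c > 0 \<Longrightarrow> ceil_quot c (int c) = 1"
  by (simp add: ceil_quot_def)

text \<open>The bound \<open>e\<close> is an integer: when it is negative, the values of \<open>h\<close> themselves are divisible by a power of \<open>p\<close>.\<close>

definition padic_deg_le :: "nat \<Rightarrow> nat \<Rightarrow> int \<Rightarrow> ('g::ab_group_add \<Rightarrow> int) \<Rightarrow> bool" where
  "padic_deg_le p c e h \<longleftrightarrow>
     (\<forall>as x. int p ^ ceil_quot c (int (length as) - e) dvd foldr \<Delta> as h x)"

lemma padic_deg_leD:
  "padic_deg_le p c e h \<Longrightarrow> k \<le> ceil_quot c (int (length as) - e) \<Longrightarrow>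
    int p ^ k dvd foldr \<Delta> as h x"
  unfolding padic_deg_le_def using power_le_dvd by blast

lemma padic_deg_le_mono:
  assumes "padic_deg_le p c e h" "e \<le> e'"
  shows "padic_deg_le p c e' h"
  unfolding padic_deg_le_def using assms by (auto intro!: padic_deg_leD ceil_quot_mono)

lemma padic_deg_le_0: "padic_deg_le p c e (\<lambda>_. 0)"
  by (simp add: padic_deg_le_def foldr_fwd_diff_zero)

lemma padic_deg_le_1: "padic_deg_le p c 0 (\<lambda>_. 1)"
  unfolding padic_deg_le_def
proof (intro allI)
  fix as and x :: 'a
  show "int p ^ ceil_quot c (int (length as) - 0) dvd foldr \<Delta> as (\<lambda>_. 1) x"
  \<comment> \<open>\<open>foldr\<close> applies the last entry first, so the last difference is the
    one that meets the constant.\<close>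
  proof (cases as rule: rev_cases)
    case Nil
    then show ?thesis by (simp add: ceil_quot_def)
  next
    case (snoc bs b)
    then show ?thesis by (simp add: fwd_diff_def foldr_fwd_diff_zero)
  qed
qed

lemma padic_deg_le_add:
  "padic_deg_le p c e g \<Longrightarrow> padic_deg_le p c e h \<Longrightarrow> padic_deg_le p c e (\<lambda>x. g x + h x)"
  by (simp add: padic_deg_le_def foldr_fwd_diff_add)

lemma padic_deg_le_sum:
  "(\<And>i. i \<in> I \<Longrightarrow> padic_deg_le p c e (h i)) \<Longrightarrow> padic_deg_le p c e (\<lambda>x. \<Sum>i\<in>I. h i x)"
  by (induction I rule: infinite_finite_induct) (auto simp: padic_deg_le_0 padic_deg_le_add)

lemma padic_deg_le_mult_left:
  "padic_deg_le p c e h \<Longrightarrow> padic_deg_le p c e (\<lambda>x. m * h x)"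
  by (simp add: padic_deg_le_def foldr_fwd_diff_mult_left)

lemma padic_deg_le_shift:
  "padic_deg_le p c e h \<Longrightarrow> padic_deg_le p c e (\<lambda>x. h (x + b))"
  by (simp add: padic_deg_le_def foldr_fwd_diff_shift)

lemma padic_deg_le_fwd_diff:
  assumes "padic_deg_le p c e h"
  shows "padic_deg_le p c (e - 1) (\<Delta> a h)"
  unfolding padic_deg_le_def
proof (intro allI)
  fix as :: "'a list" and x
  show "int p ^ ceil_quot c (int (length as) - (e - 1)) dvd foldr \<Delta> as (\<Delta> a h) x"
    using padic_deg_leD[OF assms, of _ "as @ [a]"] by (simp add: algebra_simps)
qed

lemma padic_deg_le_funpow_fwd_diff:
  "padic_deg_le p c e h \<Longrightarrow> padic_deg_le p c (e - int k) ((\<Delta> a ^^ k) h)"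
proof (induction k)
  case (Suc k)
  from padic_deg_le_fwd_diff[OF Suc.IH[OF Suc.prems], of a] show ?case
    by (simp add: algebra_simps)
qed simp

text \<open>Lowering \<open>e\<close> by \<open>c\<close> raises the ceiling by one, which the
  factor \<open>p\<close> in \<open>m\<close> pays for.\<close>

lemma padic_deg_le_prime_mult:
  assumes "padic_deg_le p c e h" "c > 0" "int p dvd m"
  shows "padic_deg_le p c (e - int c) (\<lambda>x. m * h x)"
  unfolding padic_deg_le_def
proof (intro allI)
  fix as :: "'a list" and x
  have "ceil_quot c (int (length as) - (e - int c)) \<le> Suc (ceil_quot c (int (length as) - e))"
    using ceil_quot_add_le[of c "int (length as) - e" "int c"] ceil_quot_self[OF assms(2)]
    by (simp add: algebra_simps)
  then have "int p ^ ceil_quot c (int (length as) - (e - int c)) dvd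
      int p * int p ^ ceil_quot c (int (length as) - e)"
    using le_imp_power_dvd by fastforce
  also have "\<dots> dvd m * foldr \<Delta> as h x"
    using assms by (intro mult_dvd_mono padic_deg_leD) auto
  finally show "int p ^ ceil_quot c (int (length as) - (e - int c)) dvd foldr \<Delta> as (\<lambda>x. m * h x) x"
    by (simp add: foldr_fwd_diff_mult_left)
qed

text \<open>Induction on the number of differences by the Leibniz rule: each summand has one factor
  of lower degree, and translation keeps the bound. With no difference left, the claim is
  subadditivity of the ceiling.\<close>

lemma padic_deg_le_mult:
  assumes "padic_deg_le p c e1 g" "padic_deg_le p c e2 h"
  shows "padic_deg_le p c (e1 + e2) (\<lambda>x. g x * h x)"
proof -
  have "int p ^ ceil_quot c (int (length as) - (e1 + e2)) dvd foldr \<Delta> as (\<lambda>x. g x * h x) x" for as x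
    using assms
  proof (induction as arbitrary: g h e1 e2 rule: rev_induct)
    case Nil
    have "int p ^ ceil_quot c (- (e1 + e2)) dvd int p ^ ceil_quot c (- e1) * int p ^ ceil_quot c (- e2)"
      using ceil_quot_add_le[of c "- e1" "- e2"] by (simp flip: power_add add: le_imp_power_dvd)
    also have "\<dots> dvd g x * h x"
      using padic_deg_leD[OF Nil(1), of _ "[]"] padic_deg_leD[OF Nil(2), of _ "[]"]
      by (intro mult_dvd_mono) auto
    finally show ?case by simp
  next
    case (snoc a as)
    let ?d = "int p ^ ceil_quot c (int (length (as @ [a])) - (e1 + e2))"
    have "?d dvd foldr \<Delta> as (\<lambda>x. \<Delta> a g x * h x) x"
      using snoc.IH[OF padic_deg_le_fwd_diff[OF snoc.prems(1), of a] snoc.prems(2)]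
      by (simp add: algebra_simps)
    moreover have "?d dvd foldr \<Delta> as (\<lambda>x. g (x + a) * \<Delta> a h x) x"
      using snoc.IH[OF padic_deg_le_shift[OF snoc.prems(1), of a]
          padic_deg_le_fwd_diff[OF snoc.prems(2), of a]]
      by (simp add: algebra_simps)
    moreover have "\<Delta> a (\<lambda>x. g x * h x) = (\<lambda>x. \<Delta> a g x * h x + g (x + a) * \<Delta> a h x)"
      by (auto simp: fwd_diff_def algebra_simps)
    ultimately show ?case
      by (simp add: foldr_fwd_diff_add)
  qed
  then show ?thesis
    by (simp add: padic_deg_le_def)
qed

lemma padic_deg_le_prod:
  assumes "finite I" "\<And>i. i \<in> I \<Longrightarrow> padic_deg_le p c (e i) (h i)"
  shows "padic_deg_le p c (\<Sum>i\<in>I. e i) (\<lambda>x. \<Prod>i\<in>I. h i x)"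
  using assms by (induction I) (auto simp: padic_deg_le_1 intro!: padic_deg_le_mult)

lemma padic_deg_le_sum_multiples:
  fixes b :: "nat \<Rightarrow> 'g::ab_group_add"
  assumes p: "prime p" and c: "p - 1 \<le> c" and h: "padic_deg_le p c e h"
    and b: "b 0 = 0" "\<And>t. b (Suc t) = b t + a"
  shows "padic_deg_le p c (e - int (p - 1)) (\<lambda>x. \<Sum>t<p. h (x + b t))"
  unfolding sum_newton_forward[of b, OF b]
proof (rule padic_deg_le_sum)
  fix k assume k: "k \<in> {..<p}"
  have D: "padic_deg_le p c (e - int k) ((\<Delta> a ^^ k) h)"
    by (rule padic_deg_le_funpow_fwd_diff[OF h])
  show "padic_deg_le p c (e - int (p - 1)) (\<lambda>x. int (p choose Suc k) * (\<Delta> a ^^ k) h x)"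
  \<comment> \<open>The top coefficient is 1, but there the p - 1 differences suffice. All other
    coefficients are divisible by \<open>p\<close>, which lowers the bound by
    \<open>c\<close>.\<close>
  proof (cases "k = p - 1")
    case True
    with D show ?thesis by (simp add: padic_deg_le_mult_left)
  next
    case False
    with k have "p dvd (p choose Suc k)"
      by (intro dvd_choose_prime p) auto
    moreover have "c > 0"
      using c prime_gt_1_nat[OF p] by simp
    ultimately have "padic_deg_le p c (e - int k - int c) (\<lambda>x. int (p choose Suc k) * (\<Delta> a ^^ k) h x)"
      using D by (intro padic_deg_le_prime_mult) auto
    then show ?thesis
      using c by (elim padic_deg_le_mono) linarith
  qed
qed

section \<open>Summing out one coordinate at a time\<close>

definition coord_subspace :: "('n \<times> 'N) set \<Rightarrow> (('a::zero ^ 'N) ^ 'n) set" where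
  "coord_subspace K = {x. \<forall>i j. (i, j) \<notin> K \<longrightarrow> x $ i $ j = 0}"

text \<open>Summing out a coordinate replaces \<open>h\<close> by its sum over translates along an
  axis, with bound lower by p - 1; hence the induction varies \<open>h\<close> and \<open>e\<close>.
  In the end only \<open>h 0\<close> remains.\<close>

lemma padic_deg_le_sum_coord_subspace:
  fixes h :: "('p::prime_card mod_ring ^ 'N::finite) ^ 'n::finite \<Rightarrow> int"
  assumes c: "CARD('p) - 1 \<le> c" and K: "finite K" and h: "padic_deg_le CARD('p) c e h"
  shows "int CARD('p) ^ ceil_quot c (int (card K * (CARD('p) - 1)) - e)
      dvd (\<Sum>x\<in>coord_subspace K. h x)"
  using K h
proof (induction K arbitrary: h e)
  case empty
  have "coord_subspace {} = {0 :: ('p mod_ring ^ 'N) ^ 'n}"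
    by (auto simp: coord_subspace_def vec_eq_iff)
  then show ?case
    using padic_deg_leD[OF empty, of _ "[]"] by simp
next
  case (insert k K)
  obtain i0 j0 where k: "k = (i0, j0)" by (cases k)
  define ax :: "'p mod_ring \<Rightarrow> ('p mod_ring ^ 'N) ^ 'n"
    where "ax t = (\<chi> i j. if (i, j) = k then t else 0)" for t
  define b where "b t = ax (of_nat t)" for t :: nat
  have b: "b 0 = 0" "b (Suc t) = b t + ax 1" for t
    by (auto simp: b_def ax_def vec_eq_iff)
  have surj: "(of_nat :: nat \<Rightarrow> 'p mod_ring) ` {..<CARD('p)} = UNIV"
    using surj_of_nat_mod_ring by (auto simp: image_iff)
  then have "bij_betw (of_nat :: nat \<Rightarrow> 'p mod_ring) {..<CARD('p)} UNIV"
    by (simp add: bij_betw_def eq_card_imp_inj_on)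
  then have S: "(\<Sum>t\<in>UNIV. h (x + ax t)) = (\<Sum>t<CARD('p). h (x + b t))" for x
    unfolding b_def by (rule sum.reindex_bij_betw[symmetric])
  have "(\<Sum>x\<in>coord_subspace (insert k K). h x)
      = (\<Sum>(x, t)\<in>coord_subspace K \<times> UNIV. h (x + ax t))"
    by (rule sum.reindex_bij_witness
        [where i = "\<lambda>(x, t). x + ax t" and j = "\<lambda>x. (x - ax (x $ i0 $ j0), x $ i0 $ j0)"])
      (use insert.hyps in \<open>auto simp: coord_subspace_def ax_def vec_eq_iff k\<close>)
  also have "\<dots> = (\<Sum>x\<in>coord_subspace K. \<Sum>t<CARD('p). h (x + b t))"
    by (simp add: sum.cartesian_product[symmetric] S)
  also have "int CARD('p) ^ ceil_quot c (int (card K * (CARD('p) - 1)) - (e - int (CARD('p) - 1))) dvd \<dots>"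
    using c insert.prems b by (intro insert.IH padic_deg_le_sum_multiples[OF prime_card])
  also have "int (card K * (CARD('p) - 1)) - (e - int (CARD('p) - 1))
      = int (card (insert k K) * (CARD('p) - 1)) - e"
    using insert.hyps unfolding card_insert_disjoint[OF insert.hyps] mult_Suc of_nat_add by simp
  finally show ?case .
qed

section \<open>Integer-valued functions on the integers mod p\<close>

lemma foldr_fwd_diff_dvd_from_one:
  fixes g :: "'p::prime_card mod_ring \<Rightarrow> int"
  assumes "\<And>x. q dvd (\<Delta> 1 ^^ length as) g x"
  shows "q dvd foldr \<Delta> as g x"
  using assms
proof (induction as arbitrary: g x)
  case (Cons a as)
  obtain n where n: "a = of_nat n"
    using surj_of_nat_mod_ring by blast
  \<comment> \<open>A step \<open>a\<close> is \<open>n\<close> unit steps, so its difference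
    telescopes into translates of the unit difference.\<close>
  have "foldr \<Delta> (a # as) g x = (\<Sum>t<n. foldr \<Delta> as g (x + of_nat (Suc t)) - foldr \<Delta> as g (x + of_nat t))"
    by (subst sum_lessThan_telescope) (simp add: fwd_diff_def n)
  also have "\<dots> = (\<Sum>t<n. foldr \<Delta> as (\<Delta> 1 g) (x + of_nat t))"
    by (simp add: fwd_diff_foldr[symmetric]) (simp add: fwd_diff_def ac_simps)
  also have "q dvd \<dots>"
    using Cons by (intro dvd_sum) (simp add: funpow_swap1)
  finally show ?case .
qed simp

text \<open>Each factor p costs at most p - 1 differences: p of them are traded for at least one and
  a factor p.\<close>

lemma funpow_fwd_diff_one_dvd:
  fixes g :: "'p::prime_card mod_ring \<Rightarrow> int"
  assumes "k > i * (CARD('p) - 1)"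
  shows "int CARD('p) ^ i dvd (\<Delta> 1 ^^ k) g x"
  using assms
proof (induction i arbitrary: k x)
  case (Suc i)
  let ?p = "CARD('p)"
  have p: "prime ?p" by (rule prime_card)
  have p1: "?p > 1" by (rule prime_gt_1_nat[OF p])
  \<comment> \<open>\<open>m\<close> differences and at least one more still exceed i (p - 1), as
    the induction hypothesis requires.\<close>
  obtain m where k: "k = ?p + m" and m: "Suc m > i * (?p - 1)"
    using Suc.prems p1 by (intro that[of "k - ?p"]) auto
  define h where "h = (\<Delta> 1 ^^ m) g"
  have D: "(\<Delta> 1 ^^ l) h y = (\<Delta> 1 ^^ (l + m)) g y" for l y
    by (simp add: h_def funpow_add)
  \<comment> \<open>Translation by p is the identity, so the left side cancels the term
    \<open>l = 0\<close>.\<close>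
  have "h x = (\<Sum>l\<le>?p. int (?p choose l) * (\<Delta> 1 ^^ l) h x)"
    using newton_forward[of of_nat 1 h x ?p] by (simp add: ac_simps)
  also have "{..?p} = insert 0 (insert ?p {0<..<?p})"
    using p1 by auto
  finally have "(\<Delta> 1 ^^ ?p) h x = - (\<Sum>l\<in>{0<..<?p}. int (?p choose l) * (\<Delta> 1 ^^ l) h x)"
    using p1 by simp
  also have "int ?p ^ Suc i dvd \<dots>"
    unfolding dvd_minus_iff
  proof (rule dvd_sum)
    fix l assume l: "l \<in> {0<..<?p}"
    then have "?p dvd (?p choose l)"
      by (intro dvd_choose_prime p) auto
    moreover have "int ?p ^ i dvd (\<Delta> 1 ^^ l) h x"
      unfolding D using l m by (intro Suc.IH) auto
    ultimately show "int ?p ^ Suc i dvd int (?p choose l) * (\<Delta> 1 ^^ l) h x"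
      by (auto intro: mult_dvd_mono)
  qed
  finally show ?case
    by (simp only: D k)
qed simp

section \<open>Compositions\<close>

text \<open>Differences commute, so a finite index set can replace the list; this makes inversion
  over subsets possible, and indices with equal steps stay distinct.\<close>

definition fwd_diff_set :: "('i \<Rightarrow> 'g::ab_group_add) \<Rightarrow> 'i set \<Rightarrow> ('g \<Rightarrow> 'b::ab_group_add) \<Rightarrow> 'g \<Rightarrow> 'b"
  where "fwd_diff_set a K f = Finite_Set.fold (\<lambda>k. \<Delta> (a k)) f K"

lemma fwd_diff_set_empty [simp]: "fwd_diff_set a {} f = f"
  by (simp add: fwd_diff_set_def)

lemma fwd_diff_set_insert [simp]:
  assumes "finite K" "k \<notin> K"
  shows "fwd_diff_set a (insert k K) f = \<Delta> (a k) (fwd_diff_set a K f)"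
proof -
  interpret comp_fun_commute_on UNIV "\<lambda>k. \<Delta> (a k)"
    by standard (auto simp: fun_eq_iff fwd_diff_commute)
  show ?thesis
    using assms by (simp add: fwd_diff_set_def)
qed

lemma fwd_diff_set_set:
  "distinct ks \<Longrightarrow> fwd_diff_set a (set ks) f = foldr \<Delta> (map a ks) f"
  by (induction ks) auto

lemma fwd_diff_set_eq_foldr:
  assumes "finite K"
  obtains as where "length as = card K" "fwd_diff_set a K f = foldr \<Delta> as f"
proof -
  obtain ks where "set ks = K" "distinct ks"
    using finite_distinct_list[OF assms] by blast
  then show ?thesis
    using that[of "map a ks"] fwd_diff_set_set[of ks a f] distinct_card[of ks] by simp
qed

lemma fwd_diff_set_zero_shift:
  assumes "finite K" "k \<in> K" "a k = 0"
  shows "fwd_diff_set a K f = (\<lambda>_. 0)"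
proof -
  have "fwd_diff_set a (insert k (K - {k})) f = \<Delta> (a k) (fwd_diff_set a (K - {k}) f)"
    using assms by (intro fwd_diff_set_insert) auto
  then show ?thesis
    using assms by (simp add: insert_absorb fwd_diff_def)
qed

text \<open>Expands the product over \<open>K\<close> of the translations 1 +
  \<open>\<Delta> (a k)\<close>.\<close>

lemma sum_fwd_diff_set:
  assumes "finite K"
  shows "(\<Sum>T\<in>Pow K. fwd_diff_set a T f x) = f (x + sum a K)"
  using assms
proof (induction K arbitrary: x)
  case (insert k K)
  have fin: "finite T" "k \<notin> T" if "T \<in> Pow K" for T
    using that insert.hyps finite_subset by auto
  have "(\<Sum>T\<in>Pow (insert k K). fwd_diff_set a T f x) =
      (\<Sum>T\<in>Pow K. fwd_diff_set a T f x) + (\<Sum>T\<in>insert k ` Pow K. fwd_diff_set a T f x)"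
    unfolding Pow_insert using insert.hyps by (intro sum.union_disjoint) auto
  also have "(\<Sum>T\<in>insert k ` Pow K. fwd_diff_set a T f x) =
      (\<Sum>T\<in>Pow K. fwd_diff_set a (insert k T) f x)"
    using insert.hyps by (subst sum.reindex) (auto intro!: inj_onI)
  also have "\<dots> = (\<Sum>T\<in>Pow K. fwd_diff_set a T f (x + a k) - fwd_diff_set a T f x)"
    using fin by (intro sum.cong) (auto simp: fwd_diff_def)
  also have "(\<Sum>T\<in>Pow K. fwd_diff_set a T f x) + \<dots> = (\<Sum>T\<in>Pow K. fwd_diff_set a T f (x + a k))"
    by (simp add: sum_subtractf)
  finally show ?case
    by (simp only: insert.IH sum.insert[OF insert.hyps] add.assoc)
qed simp

text \<open>Uniqueness in Moebius inversion: by induction all terms for proper subsets agree and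
  cancel.\<close>

lemma subset_sums_determine:
  fixes u v :: "'i set \<Rightarrow> 'b::ab_group_add"
  assumes "finite K" "\<And>S. S \<subseteq> K \<Longrightarrow> (\<Sum>T\<in>Pow S. u T) = (\<Sum>T\<in>Pow S. v T)"
  shows "u K = v K"
  using assms
proof (induction K rule: finite_psubset_induct)
  case (psubset K)
  have "(\<Sum>T\<in>Pow K - {K}. u T) = (\<Sum>T\<in>Pow K - {K}. v T)"
  proof (rule sum.cong[OF refl])
    fix T assume "T \<in> Pow K - {K}"
    then show "u T = v T"
      by (intro psubset.IH psubset.prems) auto
  qed
  moreover have "(\<Sum>T\<in>Pow K. w T) = w K + (\<Sum>T\<in>Pow K - {K}. w T)" for w :: "'i set \<Rightarrow> 'b"
    using psubset.hyps by (intro sum.remove) auto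
  ultimately show ?case
    using psubset.prems[OF subset_refl] by simp
qed

text \<open>
  Every \<open>f (x + sum a S)\<close> is the sum of the differences of \<open>f\<close> at \<open>x\<close> over subsets \<open>T\<close> of \<open>S\<close>; expanding \<open>g\<close> of
  this sum in turn gives a sum over the families of subsets of \<open>S\<close>. By Moebius inversion, the difference of \<open>g \<circ> f\<close>
  over \<open>K\<close> collects the families that cover \<open>K\<close>.
\<close>

lemma fwd_diff_set_comp:
  assumes K: "finite K"
  shows "fwd_diff_set a K (\<lambda>x. g (f x)) x =
    (\<Sum>\<F> | \<F> \<subseteq> Pow K \<and> \<Union>\<F> = K. fwd_diff_set (\<lambda>T. fwd_diff_set a T f x) \<F> g 0)"
proof (rule subset_sums_determine[OF K])
  fix S assume S: "S \<subseteq> K"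
  then have finS: "finite S" using K finite_subset by blast
  let ?\<gamma> = "\<lambda>\<F>. fwd_diff_set (\<lambda>T. fwd_diff_set a T f x) \<F> g 0"
  have "(\<Sum>U\<in>Pow S. \<Sum>\<F> | \<F> \<subseteq> Pow U \<and> \<Union>\<F> = U. ?\<gamma> \<F>)
      = (\<Sum>U\<in>Pow S. \<Sum>\<F> | \<F> \<in> Pow (Pow S) \<and> \<Union>\<F> = U. ?\<gamma> \<F>)"
    by (intro sum.cong refl) auto
  also have "\<dots> = (\<Sum>\<F>\<in>Pow (Pow S). ?\<gamma> \<F>)"
    using finS by (intro sum.group) auto
  \<comment> \<open>Expansion of \<open>g\<close> from the base point 0, then of \<open>f\<close>
    from \<open>x\<close>; the empty subset contributes the step \<open>f x\<close>.\<close>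
  also have "\<dots> = g (f (x + sum a S))"
    using finS by (simp only: sum_fwd_diff_set finite_Pow_iff add_0)
  finally show "(\<Sum>U\<in>Pow S. fwd_diff_set a U (\<lambda>x. g (f x)) x)
      = (\<Sum>U\<in>Pow S. \<Sum>\<F> | \<F> \<subseteq> Pow U \<and> \<Union>\<F> = U. ?\<gamma> \<F>)"
    using sum_fwd_diff_set[OF finS, of a "\<lambda>x. g (f x)" x] by simp
qed

lemma card_Union_le_mult:
  assumes "finite \<F>" "\<And>T. T \<in> \<F> \<Longrightarrow> card T \<le> d"
  shows "card (\<Union>\<F>) \<le> d * card \<F>"
  using card_Union_le_sum_card[of \<F>] sum_bounded_above[of \<F> card d] assms
  by (simp add: mult.commute)

text \<open>In a covering family, a member with more than \<open>d\<close> elements gives a zero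
  step and kills the term; otherwise covering takes at least \<open>length as / d\<close> members,
  hence that many differences of \<open>g\<close>.\<close>

lemma foldr_fwd_diff_comp_dvd:
  fixes g :: "'b::ab_group_add \<Rightarrow> int"
  assumes f: "\<And>as. length as > d \<Longrightarrow> foldr \<Delta> as f = (\<lambda>_. 0)"
    and g: "\<And>bs y. length as \<le> d * length bs \<Longrightarrow> q dvd foldr \<Delta> bs g y"
  shows "q dvd foldr \<Delta> as (\<lambda>x. g (f x)) x"
proof -
  let ?K = "{..<length as}"
  let ?c = "\<lambda>T. fwd_diff_set (nth as) T f x"
  have "foldr \<Delta> as (\<lambda>x. g (f x)) x = fwd_diff_set (nth as) ?K (\<lambda>x. g (f x)) x"
    using fwd_diff_set_set[of "[0..<length as]" "nth as" "\<lambda>x. g (f x)"]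
    by (simp add: map_nth atLeast0LessThan)
  also have "\<dots> = (\<Sum>\<F> | \<F> \<subseteq> Pow ?K \<and> \<Union>\<F> = ?K. fwd_diff_set ?c \<F> g 0)"
    by (rule fwd_diff_set_comp) simp
  also have "q dvd \<dots>"
  proof (rule dvd_sum)
    fix \<F> assume "\<F> \<in> {\<F>. \<F> \<subseteq> Pow ?K \<and> \<Union>\<F> = ?K}"
    then have sub: "\<F> \<subseteq> Pow ?K" and Un: "\<Union>\<F> = ?K" by auto
    have fin: "finite \<F>" using sub finite_subset by blast
    show "q dvd fwd_diff_set ?c \<F> g 0"
    proof (cases "\<exists>T\<in>\<F>. card T > d")
      case True
      then obtain T where T: "T \<in> \<F>" "card T > d" by blast
      have "finite T" using T sub finite_subset[of T ?K] by auto
      then obtain bs where "length bs = card T" "fwd_diff_set (nth as) T f = foldr \<Delta> bs f"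
        by (rule fwd_diff_set_eq_foldr)
      then have "?c T = 0" using f[of bs] T by simp
      then show ?thesis
        using fwd_diff_set_zero_shift[OF fin T(1), of ?c g] by simp
    next
      case False
      then have "length as \<le> d * card \<F>"
        using card_Union_le_mult[OF fin, of d] Un by (auto simp: not_less)
      moreover obtain bs where "length bs = card \<F>" "fwd_diff_set ?c \<F> g = foldr \<Delta> bs g"
        by (rule fwd_diff_set_eq_foldr[OF fin])
      ultimately show ?thesis using g[of bs 0] by simp
    qed
  qed
  finally show ?thesis .
qed

text \<open>The common \<open>D\<close> gives compositions of different degrees \<open>d\<close> the
  same step, so that they can be multiplied.\<close>

lemma padic_deg_le_comp_mod_ring:
  fixes f :: "'g::ab_group_add \<Rightarrow> 'p::prime_card mod_ring" and g :: "'p mod_ring \<Rightarrow> int"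
  assumes f: "\<And>as. length as > d \<Longrightarrow> foldr \<Delta> as f = (\<lambda>_. 0)"
    and d: "1 \<le> d" "d \<le> D"
  shows "padic_deg_le CARD('p) ((CARD('p) - 1) * D) (int ((CARD('p) - 1) * d)) (\<lambda>x. g (f x))"
  unfolding padic_deg_le_def
proof (intro allI, rule foldr_fwd_diff_comp_dvd[OF f])
  fix as :: "'g list" and bs :: "'p mod_ring list" and y
  let ?p = "CARD('p)"
  define P where "P = ?p - 1"
  let ?i = "ceil_quot (P * D) (int (length as) - int (P * d))"
  assume len: "length as \<le> d * length bs"
  have P: "P > 0"
    using prime_gt_1_nat[OF prime_card[where 'a='p]] by (simp add: P_def)
  have "?i * P < length bs" if "?i > 0"
  proof -
    let ?q = "(real (length as) - real (P * d)) / real (P * D)"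
    have i: "int ?i = \<lceil>?q\<rceil>"
      using that by (simp add: ceil_quot_def)
    then have q0: "?q > 0" using that by linarith
    \<comment> \<open>Shrinking the denominator needs a positive numerator, hence the restriction to
      \<open>?i > 0\<close>.\<close>
    have "?q \<le> (real (length as) - real (P * d)) / real (P * d)"
      using q0 P d by (intro divide_left_mono) (auto simp: zero_less_divide_iff mult_less_0_iff)
    also have "\<dots> \<le> (real (d * length bs) - real (P * d)) / real (P * d)"
      using len by (intro divide_right_mono diff_right_mono) (auto simp flip: of_nat_mult)
    also have "\<dots> = real (length bs) / real P - 1"
      using P d by (simp add: field_simps)
    finally have "?q \<le> real (length bs) / real P - 1" .
    moreover have "real ?i < ?q + 1"
      using i by linarith
    ultimately have "real ?i < real (length bs) / real P" by linarith
    then have "real (?i * P) < real (length bs)"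
      using P by (simp add: field_simps)
    then show ?thesis by linarith
  qed
  then have "int ?p ^ ?i dvd foldr \<Delta> bs g y"
    by (cases "?i = 0") (auto intro!: foldr_fwd_diff_dvd_from_one funpow_fwd_diff_one_dvd simp: P_def)
  then show "int ?p ^ ceil_quot ((?p - 1) * D) (int (length as) - int ((?p - 1) * d)) dvd foldr \<Delta> bs g y"
    by (simp add: P_def)
qed

section \<open>Functional degrees and the count of zeros\<close>

lemma fdeg_cases:
  assumes "f \<noteq> (\<lambda>_. 0)"
  obtains "fdeg f = \<infinity>"
  | d where "fdeg f = ereal (real d)" "\<And>as. length as > d \<Longrightarrow> foldr \<Delta> as f = (\<lambda>_. 0)"
proof -
  define L where "L = {n. \<exists>as. length as = n \<and> foldr \<Delta> as f \<noteq> (\<lambda>_. 0)}"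
  have fd: "fdeg f = (SUP n\<in>L. ereal (real n))"
    unfolding fdeg_def L_def by (rule arg_cong[where f = Sup]) auto
  \<comment> \<open>The empty list of steps rules out the value -\<infinity>.\<close>
  have 0: "0 \<in> L" using assms by (auto simp: L_def)
  show ?thesis
  proof (cases "finite L")
    case True
    have "fdeg f = ereal (real (Max L))"
      unfolding fd using True 0 by (intro SUP_eqI) (auto intro: Max_ge Max_in)
    moreover have "foldr \<Delta> as f = (\<lambda>_. 0)" if "length as > Max L" for as
      using that Max_ge[OF True, of "length as"] by (auto simp: L_def)
    ultimately show ?thesis by (rule that(2))
  next
    case False
    have "fdeg f = \<infinity>"
      unfolding fd
    proof (rule SUP_PInfty)
      fix n
      obtain m where "m \<in> L" "n < m"
        using False infinite_nat_iff_unbounded by blast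
      then show "\<exists>m\<in>L. ereal (real n) \<le> ereal (real m)" by (auto intro: less_imp_le)
    qed
    then show ?thesis by (rule that(1))
  qed
qed

lemma ax_katz_prime_field:
  fixes f :: "'j \<Rightarrow> (('p::prime_card mod_ring ^ 'N::finite) ^ 'n::finite) \<Rightarrow> 'p mod_ring ^ 'N"
  assumes J: "finite J"
    and f: "\<And>j as. j \<in> J \<Longrightarrow> length as > d j \<Longrightarrow> foldr \<Delta> as (f j) = (\<lambda>_. 0)"
    and d: "\<And>j. j \<in> J \<Longrightarrow> 1 \<le> d j" "\<And>j. j \<in> J \<Longrightarrow> d j \<le> D" and D: "D \<ge> 1"
  shows "CARD('p) ^ nat \<lceil>real CARD('N) * (real CARD('n) - (\<Sum>j\<in>J. real (d j))) / real D\<rceil>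
    dvd card {x. \<forall>j\<in>J. f j x = 0}"
proof -
  define P where "P = CARD('p) - 1"
  define \<chi>0 :: "'p mod_ring \<Rightarrow> int" where "\<chi>0 y = of_bool (y = 0)" for y
  define h where "h x = (\<Prod>(j, i)\<in>J \<times> UNIV. \<chi>0 (f j x $ i))" for x
  define e where "e = (\<Sum>(j, i)\<in>J \<times> (UNIV :: 'N set). int (P * d j))"
  have P: "P > 0"
    using prime_gt_1_nat[OF prime_card[where 'a='p]] by (simp add: P_def)
  have "padic_deg_le CARD('p) (P * D) (case ji of (j, i) \<Rightarrow> int (P * d j))
      (\<lambda>x. case ji of (j, i) \<Rightarrow> \<chi>0 (f j x $ i))" if "ji \<in> J \<times> UNIV" for ji
  proof (cases ji)
    case (Pair j i)
    then have "j \<in> J" using that by simp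
    then show ?thesis
      unfolding Pair prod.case P_def using d
      by (intro padic_deg_le_comp_mod_ring) (simp_all add: foldr_fwd_diff_nth f)
  qed
  then have "padic_deg_le CARD('p) (P * D) e h"
    unfolding e_def h_def using J by (intro padic_deg_le_prod) auto
  \<comment> \<open>\<open>D \<ge> 1\<close> makes the step \<open>P * D\<close> at least p - 1. The
    factor \<open>P\<close> cancels in the exponent later.\<close>
  then have "int CARD('p) ^ ceil_quot (P * D) (int (card (UNIV :: ('n \<times> 'N) set) * P) - e)
      dvd (\<Sum>x\<in>coord_subspace UNIV. h x)"
    unfolding P_def using D by (intro padic_deg_le_sum_coord_subspace) auto
  also have "(\<Sum>x\<in>coord_subspace UNIV. h x) = (\<Sum>x\<in>UNIV. of_bool (\<forall>j\<in>J. f j x = 0))"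
  proof (rule sum.cong)
    show "h x = of_bool (\<forall>j\<in>J. f j x = 0)" for x
    proof (cases "\<forall>j\<in>J. f j x = 0")
      case True
      then show ?thesis by (auto simp: h_def \<chi>0_def intro!: prod.neutral)
    next
      case False
      then obtain j i where "j \<in> J" "f j x $ i \<noteq> 0" by (auto simp: vec_eq_iff)
      then have "h x = 0"
        unfolding h_def using J by (intro prod_zero) (auto simp: \<chi>0_def)
      with False show ?thesis by simp
    qed
  qed (auto simp: coord_subspace_def)
  also have "\<dots> = int (card {x. \<forall>j\<in>J. f j x = 0})"
    by (simp add: sum_of_bool_eq)
  also have "ceil_quot (P * D) (int (card (UNIV :: ('n \<times> 'N) set) * P) - e)
      = nat \<lceil>real CARD('N) * (real CARD('n) - (\<Sum>j\<in>J. real (d j))) / real D\<rceil>"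
  proof -
    have "real_of_int e = real CARD('N) * (real P * (\<Sum>j\<in>J. real (d j)))"
      by (simp add: e_def sum.cartesian_product[symmetric] sum_distrib_left)
    then have "real_of_int (int (card (UNIV :: ('n \<times> 'N) set) * P) - e)
        = real P * (real CARD('N) * (real CARD('n) - (\<Sum>j\<in>J. real (d j))))"
      by (simp add: algebra_simps)
    then show ?thesis
      using P by (simp add: ceil_quot_def)
  qed
  finally show ?thesis
    by (simp flip: of_nat_power)
qed

theorem corollary1p9:
  fixes f :: "nat \<Rightarrow> (('p::prime_card mod_ring ^ 'N::finite) ^ 'n::finite) \<Rightarrow> 'p mod_ring ^ 'N"
    and r :: nat
    and Z :: "(('p mod_ring ^ 'N) ^ 'n) set"
  assumes "r \<ge> 1"
    and "\<And>j. j \<in> {1..r} \<Longrightarrow> f j \<noteq> (\<lambda>_. 0)"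
    and "Z = {x. \<forall>j\<in>{1..r}. f j x = 0}"
  shows "ordp CARD('p) (int (card Z)) \<ge>
    ereal_ceiling
      (ereal (real CARD('N)) * (ereal (real CARD('n)) - (\<Sum>j=1..r. fdeg (f j)))
        / (MAX j\<in>{1..r}. fdeg (f j)))"
proof (cases "\<exists>j\<in>{1..r}. fdeg (f j) = \<infinity>")
  case True
  have "(\<Sum>j=1..r. fdeg (f j)) = \<infinity>"
    using True by (subst sum_Pinfty) auto
  moreover have "(MAX j\<in>{1..r}. fdeg (f j)) = \<infinity>"
    using True by (metis Max_ge finite_atLeastAtMost finite_imageI image_eqI ereal_infty_less_eq(1))
  \<comment> \<open>The quotient is -\<infinity> / \<infinity>, which is 0 on \<open>ereal\<close>;
    the bound becomes trivial.\<close>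
  ultimately have "ereal_ceiling
      (ereal (real CARD('N)) * (ereal (real CARD('n)) - (\<Sum>j=1..r. fdeg (f j)))
        / (MAX j\<in>{1..r}. fdeg (f j))) = 0"
    by (simp add: ereal_ceiling_def)
  then show ?thesis by (simp add: ordp_def)
next
  case False
  have "\<exists>d. \<forall>j\<in>{1..r}. fdeg (f j) = ereal (real (d j)) \<and>
      (\<forall>as. length as > d j \<longrightarrow> foldr \<Delta> as (f j) = (\<lambda>_. 0))"
    using False assms(2) by (intro bchoice ballI) (metis fdeg_cases)
  then obtain d where d: "\<And>j. j \<in> {1..r} \<Longrightarrow> fdeg (f j) = ereal (real (d j))"
    and f: "\<And>j as. j \<in> {1..r} \<Longrightarrow> length as > d j \<Longrightarrow> foldr \<Delta> as (f j) = (\<lambda>_. 0)"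
    by blast
  show ?thesis
  proof (cases "card Z = 0")
    case True
    then show ?thesis by (simp add: ordp_def)
  next
    case False
    then obtain z where z: "z \<in> Z" by fastforce
    \<comment> \<open>A function of degree 0 is constant; vanishing at \<open>z\<close>, it would be
      zero everywhere.\<close>
    have d1: "1 \<le> d j" if j: "j \<in> {1..r}" for j
    proof (rule ccontr)
      assume "\<not> 1 \<le> d j"
      then have "\<Delta> (x - z) (f j) z = 0" for x
        using f[OF j, of "[x - z]"] by simp
      moreover have "f j z = 0" using z j assms(3) by auto
      ultimately have "f j x = 0" for x by (simp add: fwd_diff_def)
      with assms(2)[OF j] show False by auto
    qed
    define D where "D = Max (d ` {1..r})"
    have dD: "d j \<le> D" if "j \<in> {1..r}" for j
      using that by (simp add: D_def)
    have D1: "D \<ge> 1" using d1[of 1] dD[of 1] assms(1) by simp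
    have "(MAX j\<in>{1..r}. fdeg (f j)) = (MAX j\<in>{1..r}. ereal (real (d j)))"
      using d by (intro arg_cong[where f = Max] image_cong) auto
    also have "\<dots> = ereal (real D)"
      unfolding D_def using assms(1)
      by (subst mono_Max_commute[where f = "\<lambda>n. ereal (real n)"]) (auto simp: mono_def image_image)
    finally have M: "(MAX j\<in>{1..r}. fdeg (f j)) = ereal (real D)" .
    have S: "(\<Sum>j=1..r. fdeg (f j)) = ereal (\<Sum>j=1..r. real (d j))"
      unfolding sum_ereal[symmetric] by (intro sum.cong refl d)
    let ?q = "real CARD('N) * (real CARD('n) - (\<Sum>j=1..r. real (d j))) / real D"
    have "CARD('p) ^ nat \<lceil>?q\<rceil> dvd card Z"
      unfolding assms(3) by (rule ax_katz_prime_field) (use f d1 dD D1 in auto)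
    then have "int CARD('p) ^ nat \<lceil>?q\<rceil> dvd int (card Z)"
      by (simp flip: of_nat_power)
    then have "nat \<lceil>?q\<rceil> \<le> multiplicity (int CARD('p)) (int (card Z))"
      using False prime_gt_1_nat[OF prime_card[where 'a='p]]
      by (intro multiplicity_geI) auto
    \<comment> \<open>A negative ceiling, truncated by \<open>nat\<close>, is harmless because
      multiplicities are non-negative.\<close>
    then have "real_of_int \<lceil>?q\<rceil> \<le> real (multiplicity (int CARD('p)) (int (card Z)))"
      by linarith
    moreover have "ereal (real CARD('N)) * (ereal (real CARD('n)) - ereal (\<Sum>j=1..r. real (d j))) / ereal (real D)
        = ereal ?q"
      using D1 by simp
    ultimately show ?thesis
      using False unfolding M S ordp_def ereal_ceiling_def by simp
  qed
qed

end
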